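(* Let $A\in\mathbb{R}^{n\times n}$ be symmetric positive definite and $1\le p\le n$. For every $X_0\in\mathbb{R}^{n\times p}$ with $X_0^TX_0=I$, the sequence of gradient matrices $\mathrm{grad}\,\phi(X_k)$ generated by Riemannian gradient descent with exact line search started at $X_0$ converges to zero as $k\to\infty$.
   Context: For $X\in\mathbb{R}^{n\times p}$ with $X^TX=I$, set $\phi(X)=-\tfrac12\mathrm{Tr}(X^TAX)$. The Riemannian gradient (on the Grassmann manifold) is $\mathrm{grad}\,\phi(X)=-(I-XX^T)AX=-(AX-X(X^TAX))$. Riemannian gradient descent with exact line search: given $X_k$ with $X_k^TX_k=I$, let $G=\mathrm{grad}\,\phi(X_k)$ and, for $\mu\ge0$, let $X(\mu)=(X_k-\mu G)(I+\mu^2G^TG)^{-1/2}$ (the orthonormal polar factor of $X_k-\mu G$). Let $\mu_{opt}$ be a minimizer of $\mu\mapsto\phi(X(\mu))$ over $\mu\ge0$, and set $X_{k+1}=X(\mu_{opt})$ (if $G=0$ then $X_{k+1}=X_k$). *)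

theory Defs
  imports "HOL-Analysis.Analysis"
begin

definition sym_pos_def :: "real^'n^'n \<Rightarrow> bool" where
  "sym_pos_def A \<longleftrightarrow> transpose A = A \<and> (\<forall>x. x \<noteq> 0 \<longrightarrow> 0 < x \<bullet> (A *v x))"

(* Only meaningful for symmetric positive definite B, where such an S exists and is unique. *)
definition spd_sqrt :: "real^'n^'n \<Rightarrow> real^'n^'n" where
  "spd_sqrt B = (THE S. sym_pos_def S \<and> S ** S = B)"

definition spd_inv_sqrt :: "real^'n^'n \<Rightarrow> real^'n^'n" where
  "spd_inv_sqrt B = matrix_inv (spd_sqrt B)"

(* The columns of X :: real^'p^'n are p vectors in n-space. *)
definition orthonormal_cols :: "real^'p^'n \<Rightarrow> bool" where
  "orthonormal_cols X \<longleftrightarrow> transpose X ** X = mat 1"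

definition phi :: "real^'n^'n \<Rightarrow> real^'p^'n \<Rightarrow> real" where
  "phi A X = - (1/2) * trace (transpose X ** A ** X)"

definition rgrad :: "real^'n^'n \<Rightarrow> real^'p^'n \<Rightarrow> real^'p^'n" where
  "rgrad A X = - ((mat 1 - X ** transpose X) ** A ** X)"

definition search_curve :: "real^'n^'n \<Rightarrow> real^'p^'n \<Rightarrow> real \<Rightarrow> real^'p^'n" where
  "search_curve A X \<mu> =
     (let G = rgrad A X
      in (X - \<mu> *\<^sub>R G) ** spd_inv_sqrt (mat 1 + \<mu>\<^sup>2 *\<^sub>R (transpose G ** G)))"

(* A relation rather than a function, since the minimizer need not be unique. *)
definition rgd_step :: "real^'n^'n \<Rightarrow> real^'p^'n \<Rightarrow> real^'p^'n \<Rightarrow> bool" where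
  "rgd_step A X Y \<longleftrightarrow>
     (if rgrad A X = 0 then Y = X
      else \<exists>\<mu>. is_arg_min (\<lambda>\<nu>. phi A (search_curve A X \<nu>)) (\<lambda>\<nu>. 0 \<le> \<nu>) \<mu>
               \<and> Y = search_curve A X \<mu>)"

end

theory Submission
  imports Defs
begin

text \<open>
  Write \<open>G\<close> for the gradient at \<open>X\<close>, \<open>T = (I + \<mu>\<^sup>2 G\<^sup>T G)\<^sup>-\<^sup>1\<^sup>/\<^sup>2\<close> and \<open>H = G T\<close>. Since
  \<open>X\<^sup>T G = 0\<close> and \<open>T\<^sup>2 = I - \<mu>\<^sup>2 H\<^sup>T H\<close>, the trace \<open>Tr(X\<^sup>T A X)\<close> increases along the search curve
  by at least \<open>(2 \<mu> - \<mu>\<^sup>2 \<parallel>A\<parallel>) \<parallel>H\<parallel>\<^sup>2\<close>, and at \<open>\<mu> = 1 / \<parallel>A\<parallel>\<close> one has \<open>\<parallel>G\<parallel>\<^sup>2 \<le> 2 p \<parallel>H\<parallel>\<^sup>2\<close>. Exact line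
  search does no worse than this fixed step, so every iteration lowers \<open>\<phi>\<close> by a fixed multiple of
  \<open>\<parallel>G\<parallel>\<^sup>2\<close>; as \<open>\<phi>\<close> is bounded below on orthonormal matrices, \<open>G\<close> tends to zero. That the inverse
  square root is well defined rests on the spectral theorem, whose eigenvectors are found by maximizing
  the Rayleigh quotient.
\<close>

section \<open>The Frobenius inner product\<close>

text \<open>The inner product on \<open>real^'p^'n\<close> is the entrywise Euclidean one, so traces
  of products can be treated as inner products and \<open>norm\<close> on matrices is the Frobenius
  norm.\<close>

lemma trace_transpose_mult_eq_inner:
  fixes X Y :: "real^'p^'n"
  shows "trace (transpose X ** Y) = X \<bullet> Y"
  unfolding trace_def transpose_def matrix_matrix_mult_def inner_vec_def
  by (simp, subst sum.swap, simp)

lemma inner_matrix_mult_left: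
  fixes A :: "real^'m^'n" and X :: "real^'p^'m" and Y :: "real^'p^'n"
  shows "(A ** X) \<bullet> Y = X \<bullet> (transpose A ** Y)"
  by (simp add: trace_transpose_mult_eq_inner[symmetric] matrix_transpose_mul matrix_mul_assoc)

lemma inner_transpose:
  fixes X Y :: "real^'p^'n"
  shows "transpose X \<bullet> transpose Y = X \<bullet> Y"
  unfolding transpose_def inner_vec_def by (simp, subst sum.swap, simp)

lemma inner_matrix_mult_right:
  fixes B :: "real^'p^'m" and X :: "real^'m^'n" and Y :: "real^'p^'n"
  shows "(X ** B) \<bullet> Y = X \<bullet> (Y ** transpose B)"
proof -
  have "(X ** B) \<bullet> Y = (transpose B ** transpose X) \<bullet> transpose Y"
    by (simp add: inner_transpose[symmetric, of "X ** B"] matrix_transpose_mul)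
  also have "\<dots> = transpose X \<bullet> transpose (Y ** transpose B)"
    by (simp add: inner_matrix_mult_left matrix_transpose_mul)
  finally show ?thesis
    by (simp add: inner_transpose)
qed

section \<open>Submultiplicativity of the Frobenius norm\<close>

lemma norm_transpose:
  fixes X :: "real^'p^'n"
  shows "norm (transpose X) = norm X"
  by (simp add: norm_eq_sqrt_inner inner_transpose)

lemma norm_matrix_vector_mult_le:
  fixes A :: "real^'m^'n"
  shows "norm (A *v x) \<le> norm A * norm x"
proof -
  have "(norm (A *v x))\<^sup>2 = (\<Sum>i\<in>UNIV. (A $ i \<bullet> x)\<^sup>2)"
    by (simp only: power2_norm_eq_inner inner_vec_def[of "A *v x"])
      (simp add: matrix_vector_mul_component power2_eq_square)
  also have "\<dots> \<le> (\<Sum>i\<in>UNIV. (A $ i \<bullet> A $ i) * (x \<bullet> x))"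
    by (intro sum_mono Cauchy_Schwarz_ineq)
  also have "\<dots> = (norm A * norm x)\<^sup>2"
    by (simp add: power_mult_distrib power2_norm_eq_inner inner_vec_def[of A] sum_distrib_right)
  finally show ?thesis
    by (rule power2_le_imp_le) simp
qed

lemma norm_matrix_matrix_mult_le:
  fixes A :: "real^'m^'n" and B :: "real^'p^'m"
  shows "norm (A ** B) \<le> norm A * norm B"
proof -
  have row: "(A ** B) $ i = transpose B *v (A $ i)" for i
    by (simp add: vec_eq_iff matrix_matrix_mult_def matrix_vector_mult_def transpose_def mult.commute)
  have "(norm (A ** B))\<^sup>2 = (\<Sum>i\<in>UNIV. (norm ((A ** B) $ i))\<^sup>2)"
    by (simp add: power2_norm_eq_inner inner_vec_def[of "A ** B"])
  also have "\<dots> \<le> (\<Sum>i\<in>UNIV. (norm B * norm (A $ i))\<^sup>2)"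
    unfolding row
    by (intro sum_mono power_mono) (use norm_matrix_vector_mult_le[of "transpose B"] in
        \<open>simp_all add: norm_transpose\<close>)
  also have "\<dots> = (norm A * norm B)\<^sup>2"
    by (simp add: power_mult_distrib power2_norm_eq_inner inner_vec_def[of A] sum_distrib_left mult.commute)
  finally show ?thesis
    by (rule power2_le_imp_le) simp
qed

text \<open>Serves to obtain all distributivity and scaling rules for rectangular products at once,
  collected in \<open>matrix_mult_bilinear_simps\<close>.\<close>

lemma bounded_bilinear_matrix_matrix_mult:
  "bounded_bilinear ((**) :: real^'m^'n \<Rightarrow> real^'p^'m \<Rightarrow> real^'p^'n)"
proof
  show "\<exists>K. \<forall>(a :: real^'m^'n) (b :: real^'p^'m). norm (a ** b) \<le> norm a * norm b * K"
    using norm_matrix_matrix_mult_le by (metis mult.right_neutral)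
qed (simp_all add: vec_eq_iff matrix_matrix_mult_def algebra_simps sum.distrib sum_distrib_left)

lemmas matrix_mult_bilinear_simps =
  bounded_bilinear.diff_left[OF bounded_bilinear_matrix_matrix_mult]
  bounded_bilinear.diff_right[OF bounded_bilinear_matrix_matrix_mult]
  bounded_bilinear.add_left[OF bounded_bilinear_matrix_matrix_mult]
  bounded_bilinear.add_right[OF bounded_bilinear_matrix_matrix_mult]
  bounded_bilinear.scaleR_left[OF bounded_bilinear_matrix_matrix_mult]
  bounded_bilinear.scaleR_right[OF bounded_bilinear_matrix_matrix_mult]
  bounded_bilinear.minus_left[OF bounded_bilinear_matrix_matrix_mult]
  bounded_bilinear.minus_right[OF bounded_bilinear_matrix_matrix_mult]
  bounded_bilinear.zero_left[OF bounded_bilinear_matrix_matrix_mult]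
  bounded_bilinear.zero_right[OF bounded_bilinear_matrix_matrix_mult]

lemma inner_matrix_mult_self_le:
  fixes A :: "real^'n^'n" and Y :: "real^'p^'n"
  shows "Y \<bullet> (A ** Y) \<le> norm A * (norm Y)\<^sup>2"
proof -
  have "Y \<bullet> (A ** Y) \<le> norm Y * norm (A ** Y)"
    by (rule norm_cauchy_schwarz)
  also have "\<dots> \<le> norm Y * (norm A * norm Y)"
    by (intro mult_left_mono norm_matrix_matrix_mult_le) auto
  finally show ?thesis
    by (simp add: power2_eq_square ac_simps)
qed

text \<open>Index types are nonempty, so some axis vector would violate positivity of the zero
  matrix. This makes division by \<open>norm A\<close> legitimate.\<close>

lemma sym_pos_def_nonzero:
  fixes A :: "real^'n^'n"
  assumes "sym_pos_def A"
  shows "A \<noteq> 0"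
  using assms unfolding sym_pos_def_def
  by (metis matrix_vector_mult_0 inner_zero_right less_irrefl axis_eq_0_iff zero_neq_one)

section \<open>Spectral theorem and positive definite square roots\<close>

text \<open>A maximizer \<open>u\<close> of the Rayleigh quotient on the compact unit sphere of
  \<open>S\<close> is an eigenvector: the form \<open>q\<close> below is nonnegative on
  \<open>S\<close> and vanishes at \<open>u\<close>, so its first variation there must
  vanish.\<close>

lemma self_adjoint_eigenvector_in_subspace:
  fixes f :: "'a::euclidean_space \<Rightarrow> 'a"
  assumes lin: "linear f" and sym: "\<And>x y. f x \<bullet> y = x \<bullet> f y"
    and S: "subspace S" "f ` S \<subseteq> S" "S \<noteq> {0}"
  obtains u c where "u \<in> S" "norm u = 1" "f u = c *\<^sub>R u"
proof -
  have "compact (S \<inter> sphere 0 1)"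
    by (simp add: S(1) closed_Int_compact closed_subspace)
  moreover have "S \<inter> sphere 0 1 \<noteq> {}"
  proof -
    obtain x where x: "x \<in> S" "x \<noteq> 0"
      using S(1,3) subspace_0 by blast
    then have "(1 / norm x) *\<^sub>R x \<in> S \<inter> sphere 0 1"
      by (simp add: S(1) subspace_scale)
    then show ?thesis by blast
  qed
  moreover have "continuous_on (S \<inter> sphere 0 1) (\<lambda>x. x \<bullet> f x)"
    by (intro continuous_intros linear_continuous_on linear_conv_bounded_linear[THEN iffD1] lin)
  ultimately obtain u where u: "u \<in> S" "norm u = 1"
    and max: "\<And>x. x \<in> S \<Longrightarrow> norm x = 1 \<Longrightarrow> x \<bullet> f x \<le> u \<bullet> f u"
    using continuous_attains_sup[of "S \<inter> sphere 0 1" "\<lambda>x. x \<bullet> f x"] that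
    by (metis IntE IntI mem_sphere_0)
  define l where "l = u \<bullet> f u"
  define q where "q v = l * (v \<bullet> v) - v \<bullet> f v" for v
  have q_nonneg: "0 \<le> q v" if "v \<in> S" for v
  proof (cases "v = 0")
    case True
    then show ?thesis by (simp add: q_def linear_0[OF lin])
  next
    case False
    let ?x = "(1 / norm v) *\<^sub>R v"
    have "?x \<bullet> f ?x \<le> l"
      unfolding l_def using False that S(1) by (intro max) (auto simp: subspace_scale)
    then have "(v \<bullet> f v) / (v \<bullet> v) \<le> l"
      by (simp add: linear_scale[OF lin] power2_norm_eq_inner[symmetric] power2_eq_square)
    then show ?thesis
      using False by (simp add: q_def divide_le_eq)
  qed
  \<comment> \<open>The residual of the eigenvector equation, which is half the gradient of
    \<open>q\<close> at \<open>u\<close>; moving along it is the variation to test.\<close>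
  define w where "w = l *\<^sub>R u - f u"
  have "w \<in> S"
    unfolding w_def using S u by (auto intro: subspace_diff subspace_scale)
  define s where "s = w \<bullet> w"
  have "u \<bullet> u = 1"
    using u(2) by (simp add: norm_eq_1)
  \<comment> \<open>The constant term \<open>q u\<close> is zero, and the linear coefficient comes
    from \<open>l * (u \<bullet> w) - u \<bullet> f w = w \<bullet> w\<close>.\<close>
  have expand: "q (u + t *\<^sub>R w) = 2 * t * s + t\<^sup>2 * q w" for t
  proof -
    have wu: "w \<bullet> f u = u \<bullet> f w"
      using sym[of u w] by (simp add: inner_commute)
    have "s = l * (u \<bullet> w) - u \<bullet> f w"
      unfolding s_def by (subst w_def) (simp add: inner_diff_left sym)
    then have ufw: "u \<bullet> f w = l * (u \<bullet> w) - s"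
      by simp
    show ?thesis
      using \<open>u \<bullet> u = 1\<close>
      by (simp add: q_def l_def[symmetric] linear_add[OF lin] linear_scale[OF lin] inner_simps
          inner_commute[of w u] wu ufw power2_eq_square algebra_simps)
  qed
  \<comment> \<open>Adding 1 keeps \<open>d\<close> positive even if \<open>q w = 0\<close>; the
    choice \<open>t = - s / d\<close> then makes the expansion negative unless
    \<open>s = 0\<close>.\<close>
  define d where "d = q w + 1"
  have "d > 0" using q_nonneg[OF \<open>w \<in> S\<close>] by (simp add: d_def)
  have "0 \<le> q (u + (- s / d) *\<^sub>R w)"
    using S(1) \<open>w \<in> S\<close> u by (intro q_nonneg) (simp_all only: subspace_add subspace_scale)
  also have "\<dots> = 2 * (- s / d) * s + (- s / d)\<^sup>2 * (d - 1)"
    by (simp only: expand d_def) simp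
  also have "\<dots> = - (s\<^sup>2 * (d + 1)) / d\<^sup>2"
    using \<open>d > 0\<close> by (simp add: field_simps power2_eq_square)
  finally have "s\<^sup>2 * (d + 1) \<le> 0"
    using \<open>d > 0\<close> by (simp add: divide_le_0_iff zero_le_divide_iff)
  then have "s = 0"
    using \<open>d > 0\<close> by (simp add: mult_le_0_iff)
  then have "f u = l *\<^sub>R u"
    by (simp add: s_def w_def)
  with u that show ?thesis by blast
qed

text \<open>Induction on dimension: split off a unit eigenvector \<open>u\<close> and continue in
  its orthogonal complement within \<open>S\<close>, which is invariant because
  \<open>u \<bullet> f x = f u \<bullet> x\<close> is a multiple of
  \<open>u \<bullet> x\<close>.\<close>

lemma self_adjoint_orthonormal_eigenbasis_subspace:
  fixes f :: "'a::euclidean_space \<Rightarrow> 'a"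
  assumes lin: "linear f" and sym: "\<And>x y. f x \<bullet> y = x \<bullet> f y"
    and "subspace S" "f ` S \<subseteq> S"
  shows "\<exists>B. pairwise orthogonal B \<and> (\<forall>b\<in>B. norm b = 1 \<and> (\<exists>c. f b = c *\<^sub>R b)) \<and> span B = S"
  using assms(3,4)
proof (induction "dim S" arbitrary: S rule: less_induct)
  case less
  show ?case
  proof (cases "S = {0}")
    case True
    then show ?thesis by (intro exI[of _ "{}"]) auto
  next
    case False
    then obtain u c where u: "u \<in> S" "norm u = 1" "f u = c *\<^sub>R u"
      using self_adjoint_eigenvector_in_subspace[OF lin sym less.prems] by blast
    have uu: "u \<bullet> u = 1" using u(2) by (simp add: norm_eq_1)
    define S' where "S' = S \<inter> {x. u \<bullet> x = 0}"
    have sub': "subspace S'"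
      unfolding S'_def by (rule subspace_inter[OF less.prems(1) subspace_hyperplane])
    have inv': "f ` S' \<subseteq> S'"
      using less.prems(2) by (auto simp: S'_def sym[symmetric] u(3))
    have "u \<notin> S'" "S' \<subseteq> S"
      using uu by (auto simp: S'_def)
    with u(1) have "S' \<subset> S" by blast
    then have "dim S' < dim S"
      by (metis dim_psubset less.prems(1) span_eq_iff sub')
    then obtain B where B: "pairwise orthogonal B"
      "\<forall>b\<in>B. norm b = 1 \<and> (\<exists>c. f b = c *\<^sub>R b)" "span B = S'"
      using less.hyps sub' inv' by blast
    have BS': "B \<subseteq> S'" using B(3) span_superset by blast
    have "pairwise orthogonal (insert u B)"
      using B(1) BS' by (auto simp: pairwise_insert orthogonal_def S'_def inner_commute)
    moreover have "span (insert u B) = S"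
    proof
      show "span (insert u B) \<subseteq> S"
        using BS' u(1) by (intro span_minimal less.prems) (auto simp: S'_def)
      show "S \<subseteq> span (insert u B)"
      proof
        fix x assume "x \<in> S"
        then have "x - (u \<bullet> x) *\<^sub>R u \<in> span B"
          unfolding B(3) S'_def using u(1) less.prems(1) uu
          by (auto intro: subspace_diff subspace_scale simp: inner_diff_right)
        then show "x \<in> span (insert u B)"
          by (auto simp: span_insert)
      qed
    qed
    ultimately show ?thesis
      using B(2) u by (intro exI[of _ "insert u B"]) auto
  qed
qed

lemma symmetric_matrix_orthonormal_eigenbasis:
  fixes M :: "real^'n^'n"
  assumes "transpose M = M"
  obtains B c where "finite B" "pairwise orthogonal B" "\<And>b. b \<in> B \<Longrightarrow> norm b = 1"
    "\<And>b. b \<in> B \<Longrightarrow> M *v b = c b *\<^sub>R b" "\<And>x. (\<Sum>b\<in>B. (x \<bullet> b) *\<^sub>R b) = x"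
proof -
  have sym: "(M *v x) \<bullet> y = x \<bullet> (M *v y)" for x y
    using assms by (metis dot_lmul_matrix vector_transpose_matrix)
  obtain B where B: "pairwise orthogonal B" "\<forall>b\<in>B. norm b = 1 \<and> (\<exists>c. M *v b = c *\<^sub>R b)"
    "span B = UNIV"
    using self_adjoint_orthonormal_eigenbasis_subspace[OF matrix_vector_mul_linear sym, of UNIV]
    by auto
  have "finite B"
    using B(1) by (rule pairwise_orthogonal_imp_finite)
  obtain c where "\<forall>b\<in>B. M *v b = c b *\<^sub>R b"
    using B(2) by metis
  moreover have "(\<Sum>b\<in>B. (x \<bullet> b) *\<^sub>R b) = x" for x
    using B \<open>finite B\<close> by (intro orthonormal_basis_expand) auto
  ultimately show ?thesis
    using that B \<open>finite B\<close> by blast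
qed

section \<open>Existence and uniqueness of the positive definite square root\<close>

lemma sym_pos_def_sqrt_exists:
  fixes M :: "real^'n^'n"
  assumes "sym_pos_def M"
  shows "\<exists>S. sym_pos_def S \<and> S ** S = M"
proof -
  have sym: "transpose M = M" and pos: "\<And>x. x \<noteq> 0 \<Longrightarrow> 0 < x \<bullet> (M *v x)"
    using assms by (auto simp: sym_pos_def_def)
  obtain B c where B: "finite B" "pairwise orthogonal B" "\<And>b. b \<in> B \<Longrightarrow> norm b = 1"
    and eig: "\<And>b. b \<in> B \<Longrightarrow> M *v b = c b *\<^sub>R b"
    and expand: "\<And>x. (\<Sum>b\<in>B. (x \<bullet> b) *\<^sub>R b) = x"
    using symmetric_matrix_orthonormal_eigenbasis[OF sym] by blast
  have c_pos: "0 < c b" if "b \<in> B" for b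
    using pos[of b] B(3)[OF that] that by (force simp: eig norm_eq_1)
  \<comment> \<open>Keeps the eigenvectors of \<open>M\<close> and takes square roots of the
    eigenvalues.\<close>
  define g where "g x = (\<Sum>b\<in>B. (sqrt (c b) * (x \<bullet> b)) *\<^sub>R b)" for x
  have lin: "linear g"
    by (rule linearI)
      (simp_all add: g_def inner_add_left algebra_simps sum.distrib scaleR_sum_right)
  define S where "S = matrix g"
  have S: "S *v x = g x" for x
    by (simp add: S_def matrix_works lin)
  have g_sym: "x \<bullet> g y = g x \<bullet> y" for x y
    by (simp add: g_def inner_sum_left inner_sum_right inner_commute ac_simps)
  have g_eig: "g b = sqrt (c b) *\<^sub>R b" if "b \<in> B" for b
  proof -
    have "g b = (\<Sum>a\<in>B. if a = b then sqrt (c b) *\<^sub>R b else 0)"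
      unfolding g_def using that B(2,3)
      by (intro sum.cong) (auto simp: pairwise_def orthogonal_def norm_eq_1)
    then show ?thesis using that B(1) by simp
  qed
  have "transpose S *v x = S *v x" for x
  proof -
    have "(transpose S *v x) \<bullet> y = (S *v x) \<bullet> y" for y
      by (simp add: transpose_matrix_vector dot_lmul_matrix S g_sym)
    then show ?thesis using vector_eq_rdot by blast
  qed
  then have "transpose S = S"
    by (simp add: matrix_eq)
  moreover have "0 < x \<bullet> (S *v x)" if "x \<noteq> 0" for x
  proof -
    have eq: "x \<bullet> g x = (\<Sum>b\<in>B. sqrt (c b) * (x \<bullet> b)\<^sup>2)"
      by (simp add: g_def inner_sum_right power2_eq_square ac_simps)
    have "\<exists>b\<in>B. x \<bullet> b \<noteq> 0"
    proof (rule ccontr)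
      assume "\<not> ?thesis"
      then have "(\<Sum>b\<in>B. (x \<bullet> b) *\<^sub>R b) = 0" by simp
      with expand[of x] that show False by simp
    qed
    then obtain b where b: "b \<in> B" "x \<bullet> b \<noteq> 0" by blast
    have "0 < (\<Sum>b\<in>B. sqrt (c b) * (x \<bullet> b)\<^sup>2)"
    proof (rule sum_pos2[OF B(1) b(1)])
      show "0 < sqrt (c b) * (x \<bullet> b)\<^sup>2"
        using c_pos[OF b(1)] b(2) by simp
      show "0 \<le> sqrt (c a) * (x \<bullet> a)\<^sup>2" if "a \<in> B" for a
        using c_pos[OF that] by simp
    qed
    then show ?thesis
      by (simp only: S eq)
  qed
  moreover have "S ** S = M"
  proof -
    have on_basis: "g (g b) = M *v b" if "b \<in> B" for b
      using that c_pos[OF that] by (simp add: g_eig linear_scale[OF lin] eig)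
    have "g (g x) = M *v x" for x
    proof -
      have "g (g (\<Sum>b\<in>B. (x \<bullet> b) *\<^sub>R b)) = M *v (\<Sum>b\<in>B. (x \<bullet> b) *\<^sub>R b)"
        by (simp add: linear_sum[OF lin] linear_scale[OF lin] on_basis
            linear_sum[OF matrix_vector_mul_linear] matrix_vector_mult_scaleR)
      then show ?thesis by (simp add: expand)
    qed
    then show ?thesis
      by (simp add: matrix_eq matrix_vector_mul_assoc[symmetric] S)
  qed
  ultimately show ?thesis
    by (auto simp: sym_pos_def_def)
qed

text \<open>The Frobenius pairing is the sum of the quadratic form of \<open>S\<close> over the
  columns of \<open>Y\<close>, so definiteness passes from vectors to rectangular matrices.\<close>

lemma sym_pos_def_inner_matrix_mult:
  fixes S :: "real^'n^'n" and Y :: "real^'p^'n"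
  assumes "sym_pos_def S"
  shows sym_pos_def_inner_matrix_mult_nonneg: "0 \<le> Y \<bullet> (S ** Y)"
    and sym_pos_def_inner_matrix_mult_eq_0: "Y \<bullet> (S ** Y) = 0 \<Longrightarrow> Y = 0"
proof -
  have nonneg: "0 \<le> x \<bullet> (S *v x)" for x
    using assms by (cases "x = 0") (auto simp: sym_pos_def_def less_imp_le)
  have eq: "Y \<bullet> (S ** Y) = (\<Sum>j\<in>UNIV. column j Y \<bullet> (S *v column j Y))"
  proof -
    have "Y \<bullet> (S ** Y) = (\<Sum>i\<in>UNIV. \<Sum>j\<in>UNIV. Y$i$j * (S ** Y)$i$j)"
      by (simp add: inner_vec_def)
    also have "\<dots> = (\<Sum>j\<in>UNIV. \<Sum>i\<in>UNIV. Y$i$j * (S ** Y)$i$j)"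
      by (rule sum.swap)
    finally show ?thesis
      by (simp add: inner_vec_def column_def matrix_matrix_mult_def matrix_vector_mult_def)
  qed
  show "0 \<le> Y \<bullet> (S ** Y)"
    unfolding eq by (intro sum_nonneg nonneg)
  show "Y = 0" if "Y \<bullet> (S ** Y) = 0"
  proof -
    have "column j Y \<bullet> (S *v column j Y) = 0" for j
      using that unfolding eq by (subst (asm) sum_nonneg_eq_0_iff) (auto intro: nonneg)
    then have "column j Y = 0" for j
      using assms unfolding sym_pos_def_def by (metis less_irrefl)
    then show ?thesis by (simp add: vec_eq_iff column_def)
  qed
qed

text \<open>The difference \<open>D = S - T\<close> of two roots satisfies \<open>S D + D T = 0\<close>; pairing with \<open>D\<close>
  gives a sum of two nonnegative terms.\<close>
lemma sym_pos_def_sqrt_unique: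
  fixes S T :: "real^'n^'n"
  assumes "sym_pos_def S" "sym_pos_def T" "S ** S = T ** T"
  shows "S = T"
proof -
  define D where "D = S - T"
  have tr: "transpose D = D" "transpose T = T"
    using assms(1,2) by (simp_all add: D_def sym_pos_def_def transpose_def vec_eq_iff)
  have "S ** D + D ** T = 0"
    by (simp add: D_def matrix_mult_bilinear_simps assms(3))
  then have "D \<bullet> (S ** D) + D \<bullet> (D ** T) = 0"
    by (metis inner_add_right inner_zero_right)
  moreover have "D \<bullet> (D ** T) = D \<bullet> (T ** D)"
    using inner_transpose[of D "D ** T"] by (simp add: matrix_transpose_mul tr)
  ultimately have "D \<bullet> (S ** D) = 0"
    using sym_pos_def_inner_matrix_mult_nonneg[OF assms(1), of D]
      sym_pos_def_inner_matrix_mult_nonneg[OF assms(2), of D] by linarith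
  then show ?thesis
    using sym_pos_def_inner_matrix_mult_eq_0[OF assms(1)] by (force simp: D_def)
qed

text \<open>Existence and uniqueness of the root justify the definite description in
  \<open>spd_sqrt\<close>; the identities then follow by regrouping products of the root and its
  two-sided inverse.\<close>

lemma spd_inv_sqrt:
  fixes M :: "real^'n^'n"
  assumes "sym_pos_def M"
  shows "transpose (spd_inv_sqrt M) = spd_inv_sqrt M"
    and "spd_inv_sqrt M ** M ** spd_inv_sqrt M = mat 1"
    and "spd_inv_sqrt M ** spd_inv_sqrt M ** M = mat 1"
proof -
  define S where "S = spd_sqrt M"
  define T where "T = spd_inv_sqrt M"
  have "\<exists>!S. sym_pos_def S \<and> S ** S = M"
    using sym_pos_def_sqrt_exists[OF assms] sym_pos_def_sqrt_unique by metis
  from theI'[OF this] have S: "sym_pos_def S" "S ** S = M"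
    by (simp_all add: S_def spd_sqrt_def)
  have "x = 0" if "S *v x = 0" for x
    using S(1) that by (metis sym_pos_def_def inner_zero_right less_irrefl)
  then have "\<exists>T. T ** S = mat 1"
    by (simp add: matrix_left_invertible_ker)
  then have "invertible S"
    by (metis invertible_def matrix_left_right_inverse)
  then have inv: "S ** T = mat 1" "T ** S = mat 1"
    using someI_ex[OF \<open>invertible S\<close>[unfolded invertible_def]]
    by (simp_all add: T_def spd_inv_sqrt_def S_def[symmetric] matrix_inv_def)
  \<comment> \<open>Symmetry of \<open>S\<close> makes \<open>transpose T\<close> a left inverse of
    \<open>S\<close> as well, hence equal to \<open>T\<close>.\<close>
  have "transpose T ** S = transpose (S ** T)"
    using S(1) by (simp add: matrix_transpose_mul sym_pos_def_def)
  then have "transpose T ** S = mat 1"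
    by (simp add: inv(1))
  then have "transpose T ** (S ** T) = T"
    by (simp add: matrix_mul_assoc)
  then show "transpose (spd_inv_sqrt M) = spd_inv_sqrt M"
    by (simp add: inv(1) T_def[symmetric])
  have "T ** (S ** S) ** T = (T ** S) ** (S ** T)"
    by (simp add: matrix_mul_assoc)
  then show "spd_inv_sqrt M ** M ** spd_inv_sqrt M = mat 1"
    by (simp add: inv T_def[symmetric] S(2))
  have "T ** T ** (S ** S) = T ** (T ** S) ** S"
    by (simp add: matrix_mul_assoc)
  then show "spd_inv_sqrt M ** spd_inv_sqrt M ** M = mat 1"
    by (simp add: inv T_def[symmetric] S(2))
qed

section \<open>Sufficient decrease along the search curve\<close>

lemma phi_eq_inner: "phi A X = - (1/2) * (X \<bullet> (A ** X))"
  by (simp add: phi_def trace_transpose_mult_eq_inner[symmetric] matrix_mul_assoc)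

lemma norm_orthonormal_cols:
  fixes X :: "real^'p^'n"
  assumes "orthonormal_cols X"
  shows "(norm X)\<^sup>2 = CARD('p)"
  using assms trace_transpose_mult_eq_inner[of X X]
  by (simp add: orthonormal_cols_def power2_norm_eq_inner trace_def mat_def)

text \<open>\<open>rgrad A X\<close> is minus the part of \<open>A ** X\<close> orthogonal to the
  column space of \<open>X\<close>; these are the two facts about the gradient on which the later
  estimates rest.\<close>

lemma orthonormal_cols_rgrad:
  fixes X :: "real^'p^'n"
  assumes "orthonormal_cols X"
  shows "transpose X ** rgrad A X = 0"
    and "A ** X = X ** (transpose X ** A ** X) - rgrad A X"
proof -
  show decomp: "A ** X = X ** (transpose X ** A ** X) - rgrad A X"
    by (simp add: rgrad_def matrix_mult_bilinear_simps matrix_mul_assoc)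
  then have "rgrad A X = X ** (transpose X ** A ** X) - A ** X"
    by simp
  then show "transpose X ** rgrad A X = 0"
    using assms by (simp add: matrix_mult_bilinear_simps matrix_mul_assoc orthonormal_cols_def)
qed

text \<open>Up to sign the gradient is an orthogonal projection of \<open>A ** X\<close>, and
  projecting does not increase the norm.\<close>

lemma norm_rgrad_le:
  fixes X :: "real^'p^'n"
  assumes "orthonormal_cols X"
  shows "norm (rgrad A X) \<le> norm A * norm X"
proof -
  let ?G = "rgrad A X"
  have "(X ** (transpose X ** A ** X)) \<bullet> ?G = 0"
    using inner_matrix_mult_left[of X "transpose X ** A ** X" ?G] orthonormal_cols_rgrad(1)[OF assms]
    by (simp add: inner_zero_right)
  then have "(A ** X) \<bullet> ?G = - (?G \<bullet> ?G)"
    by (subst orthonormal_cols_rgrad(2)[OF assms]) (simp add: inner_diff_left)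
  then have "(norm ?G)\<^sup>2 = - ((A ** X) \<bullet> ?G)"
    by (simp add: power2_norm_eq_inner)
  also have "\<dots> \<le> norm (A ** X) * norm ?G"
    using norm_cauchy_schwarz[of "- (A ** X)" ?G] by simp
  finally have "norm ?G \<le> norm (A ** X)"
    by (cases "?G = 0") (auto simp: power2_eq_square)
  then show ?thesis
    using norm_matrix_matrix_mult_le[of A X] by linarith
qed

text \<open>The quadratic form at \<open>x\<close> is the squared norm of \<open>x\<close> plus
  \<open>\<mu>\<^sup>2\<close> times that of \<open>G *v x\<close>. Hence
  \<open>spd_inv_sqrt\<close> is meaningful all along the search curve.\<close>

lemma sym_pos_def_one_plus_gram:
  fixes G :: "real^'p^'n"
  shows "sym_pos_def (mat 1 + \<mu>\<^sup>2 *\<^sub>R (transpose G ** G))"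
proof -
  have "transpose (mat 1 + \<mu>\<^sup>2 *\<^sub>R (transpose G ** G)) = mat 1 + \<mu>\<^sup>2 *\<^sub>R (transpose G ** G)"
    by (simp add: vec_eq_iff transpose_def mat_def matrix_matrix_mult_def ac_simps)
  moreover have "0 < x \<bullet> ((mat 1 + \<mu>\<^sup>2 *\<^sub>R (transpose G ** G)) *v x)" if "x \<noteq> 0" for x
  proof -
    have "x \<bullet> ((transpose G ** G) *v x) = (G *v x) \<bullet> (G *v x)"
      by (metis dot_lmul_matrix inner_commute matrix_vector_mul_assoc transpose_matrix_vector)
    then have "x \<bullet> ((mat 1 + \<mu>\<^sup>2 *\<^sub>R (transpose G ** G)) *v x)
        = x \<bullet> x + \<mu>\<^sup>2 * ((G *v x) \<bullet> (G *v x))"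
      by (simp add: matrix_vector_mult_add_rdistrib inner_add_right scaleR_matrix_vector_assoc[symmetric])
    also have "\<dots> > 0"
      using that by (intro add_pos_nonneg) auto
    finally show ?thesis .
  qed
  ultimately show ?thesis by (simp add: sym_pos_def_def)
qed

text \<open>The cross terms vanish by \<open>transpose X ** G = 0\<close>, so the Gram matrix of
  \<open>X - \<mu> *\<^sub>R G\<close> is exactly \<open>M\<close>, which the factor
  \<open>T\<close> normalizes to the identity.\<close>

lemma orthonormal_cols_search_curve:
  fixes X :: "real^'p^'n"
  assumes "orthonormal_cols X"
  shows "orthonormal_cols (search_curve A X \<mu>)"
proof -
  define G where "G = rgrad A X"
  define M where "M = mat 1 + \<mu>\<^sup>2 *\<^sub>R (transpose G ** G)"
  define T where "T = spd_inv_sqrt M"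
  have T: "transpose T = T" "T ** M ** T = mat 1"
    using spd_inv_sqrt[of M] sym_pos_def_one_plus_gram[of \<mu> G] by (simp_all add: M_def T_def)
  have XG: "transpose X ** G = 0"
    using orthonormal_cols_rgrad(1)[OF assms] by (simp add: G_def)
  have "transpose G ** X = transpose (transpose X ** G)"
    by (simp add: matrix_transpose_mul)
  then have GX: "transpose G ** X = 0"
    by (simp add: XG) (simp add: vec_eq_iff transpose_def)
  have tr: "transpose (X - \<mu> *\<^sub>R G) = transpose X - \<mu> *\<^sub>R transpose G"
    by (simp add: vec_eq_iff transpose_def)
  have "transpose (X - \<mu> *\<^sub>R G) ** (X - \<mu> *\<^sub>R G) = M"
    using assms XG GX
    by (simp add: tr matrix_mult_bilinear_simps orthonormal_cols_def M_def power2_eq_square)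
  moreover have "transpose (Y ** T) ** (Y ** T) = T ** (transpose Y ** Y) ** T"
    for Y :: "real^'p^'n"
    by (simp add: matrix_transpose_mul T(1) matrix_mul_assoc)
  ultimately have "transpose ((X - \<mu> *\<^sub>R G) ** T) ** ((X - \<mu> *\<^sub>R G) ** T) = T ** M ** T"
    by simp
  then show ?thesis
    by (simp add: orthonormal_cols_def search_curve_def Let_def G_def[symmetric] M_def[symmetric]
        T_def[symmetric] T(2))
qed

text \<open>In the denominator, 4 combines the factor 1/2 in \<open>phi\<close> with the 2 in the
  comparison of \<open>norm G\<close> and \<open>norm H\<close>, which also supplies
  \<open>CARD('p)\<close>; \<open>norm A\<close> comes from the step length.\<close>

lemma phi_search_curve_decrease:
  fixes A :: "real^'n^'n" and X :: "real^'p^'n"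
  assumes A: "sym_pos_def A" and X: "orthonormal_cols X"
  shows "phi A (search_curve A X (1 / norm A))
    \<le> phi A X - (norm (rgrad A X))\<^sup>2 / (4 * CARD('p) * norm A)"
proof -
  \<comment> \<open>Maximizes the guaranteed gain factor
    \<open>2 * \<mu> - \<mu>\<^sup>2 * norm A\<close>, whose maximal value is again
    \<open>1 / norm A\<close>.\<close>
  define \<mu> where "\<mu> = 1 / norm A"
  define G where "G = rgrad A X"
  define M where "M = mat 1 + \<mu>\<^sup>2 *\<^sub>R (transpose G ** G)"
  define T where "T = spd_inv_sqrt M"
  define H where "H = G ** T"
  define V where "V = X ** T"
  have "A \<noteq> 0"
    using A by (rule sym_pos_def_nonzero)
  then have "norm A > 0" by simp
  then have "\<mu> > 0" by (simp add: \<mu>_def)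
  have symA: "transpose A = A" using A by (simp add: sym_pos_def_def)
  have T: "transpose T = T" "T ** M ** T = mat 1" "T ** T ** M = mat 1"
    using spd_inv_sqrt[of M] sym_pos_def_one_plus_gram[of \<mu> G] by (simp_all add: M_def T_def)
  have XG: "transpose X ** G = 0"
    using orthonormal_cols_rgrad(1)[OF X] by (simp add: G_def)
  have TT: "T ** T = mat 1 - \<mu>\<^sup>2 *\<^sub>R (transpose H ** H)"
  proof -
    have "mat 1 = T ** (mat 1 + \<mu>\<^sup>2 *\<^sub>R (transpose G ** G)) ** T"
      using T(2) by (simp add: M_def)
    also have "\<dots> = T ** T + \<mu>\<^sup>2 *\<^sub>R (transpose H ** H)"
      by (simp add: matrix_mult_bilinear_simps H_def matrix_transpose_mul T(1) matrix_mul_assoc)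
    finally show ?thesis by (simp add: eq_diff_eq)
  qed
  \<comment> \<open>By \<open>TT\<close>, the loss from normalizing \<open>X\<close> is
    \<open>\<mu>\<^sup>2\<close> times the form of \<open>A\<close> at
    \<open>X ** transpose H\<close>, whose norm is that of \<open>H\<close> since \<open>X\<close>
    has orthonormal columns.\<close>
  have VV: "V \<bullet> (A ** V) \<ge> X \<bullet> (A ** X) - \<mu>\<^sup>2 * (norm A * (norm H)\<^sup>2)"
  proof -
    let ?Y = "X ** transpose H"
    have "V \<bullet> (A ** V) = X \<bullet> (A ** X ** (T ** T))"
      by (simp add: V_def inner_matrix_mult_right T(1) matrix_mul_assoc)
    also have "\<dots> = X \<bullet> (A ** X) - \<mu>\<^sup>2 * (X \<bullet> (A ** X ** transpose H ** H))"
      by (simp add: TT matrix_mult_bilinear_simps inner_diff_right matrix_mul_assoc)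
    also have "X \<bullet> (A ** X ** transpose H ** H) = ?Y \<bullet> (A ** ?Y)"
      by (simp add: inner_matrix_mult_right transpose_transpose matrix_mul_assoc)
    finally have eq: "V \<bullet> (A ** V) = X \<bullet> (A ** X) - \<mu>\<^sup>2 * (?Y \<bullet> (A ** ?Y))" .
    have "(norm ?Y)\<^sup>2 = (norm H)\<^sup>2"
      using X inner_matrix_mult_left[of X "transpose H" ?Y]
      by (simp add: power2_norm_eq_inner matrix_mul_assoc orthonormal_cols_def inner_transpose)
    then show ?thesis
      unfolding eq using inner_matrix_mult_self_le[of ?Y A] by (simp add: mult_left_mono)
  qed
  \<comment> \<open>Of the two parts of \<open>A ** X ** T\<close>, the one in the column space of
    \<open>X\<close> is orthogonal to \<open>H\<close>, and the other is \<open>- H\<close>.\<close>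
  have VH: "V \<bullet> (A ** H) = - (norm H)\<^sup>2"
  proof -
    let ?R = "transpose X ** A ** X"
    have "V \<bullet> (A ** H) = (A ** X ** T) \<bullet> H"
      by (metis V_def inner_matrix_mult_left matrix_mul_assoc symA)
    also have "A ** X ** T = X ** (?R ** T) - H"
      by (subst orthonormal_cols_rgrad(2)[OF X])
        (simp add: matrix_mult_bilinear_simps matrix_mul_assoc H_def G_def)
    also have "(X ** (?R ** T) - H) \<bullet> H = (?R ** T) \<bullet> (transpose X ** H) - H \<bullet> H"
      by (simp add: inner_diff_left inner_matrix_mult_left[of X "?R ** T"])
    also have "transpose X ** H = 0"
      by (simp add: H_def matrix_mul_assoc XG matrix_mult_bilinear_simps)
    finally show ?thesis by (simp add: power2_norm_eq_inner)
  qed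
  have HV: "H \<bullet> (A ** V) = V \<bullet> (A ** H)"
    by (metis inner_commute inner_matrix_mult_left symA)
  define Z where "Z = search_curve A X \<mu>"
  have Z: "Z = V - \<mu> *\<^sub>R H"
    by (simp add: Z_def search_curve_def Let_def G_def[symmetric] M_def[symmetric] T_def[symmetric]
        V_def H_def matrix_mult_bilinear_simps)
  have "Z \<bullet> (A ** Z) = V \<bullet> (A ** V) + 2 * \<mu> * (norm H)\<^sup>2 + \<mu>\<^sup>2 * (H \<bullet> (A ** H))"
    by (simp add: Z matrix_mult_bilinear_simps inner_simps HV VH power2_eq_square algebra_simps)
  \<comment> \<open>The quadratic term in \<open>H\<close> is nonnegative because \<open>A\<close>
    is positive definite, so it is dropped.\<close>
  then have "Z \<bullet> (A ** Z) \<ge> X \<bullet> (A ** X) + (2 * \<mu> - \<mu>\<^sup>2 * norm A) * (norm H)\<^sup>2"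
    using VV sym_pos_def_inner_matrix_mult_nonneg[OF A, of H]
    by (smt (verit) mult.assoc left_diff_distrib mult_nonneg_nonneg zero_le_power2)
  moreover have "2 * \<mu> - \<mu>\<^sup>2 * norm A = \<mu>"
    using \<open>norm A > 0\<close> by (simp add: \<mu>_def power2_eq_square)
  ultimately have dec: "Z \<bullet> (A ** Z) \<ge> X \<bullet> (A ** X) + \<mu> * (norm H)\<^sup>2"
    by simp
  have "(norm G)\<^sup>2 \<le> 2 * CARD('p) * (norm H)\<^sup>2"
  proof -
    \<comment> \<open>Obtained by inserting \<open>T ** T ** M = mat 1\<close> into
      \<open>G \<bullet> G\<close> and expanding \<open>M\<close>.\<close>
    have MH: "(norm G)\<^sup>2 = (norm H)\<^sup>2 + \<mu>\<^sup>2 * (norm (transpose G ** H))\<^sup>2"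
    proof -
      have "(norm G)\<^sup>2 = G \<bullet> (G ** (T ** T ** M))"
        by (simp add: T(3) power2_norm_eq_inner)
      also have "\<dots> = G \<bullet> (G ** T ** T) + \<mu>\<^sup>2 * (G \<bullet> (G ** T ** T ** transpose G ** G))"
        by (simp add: M_def matrix_mult_bilinear_simps inner_add_right matrix_mul_assoc)
      also have "G \<bullet> (G ** T ** T) = H \<bullet> H"
        by (simp add: H_def inner_matrix_mult_right T(1))
      also have "G \<bullet> (G ** T ** T ** transpose G ** G) = (G ** transpose G ** G ** T) \<bullet> H"
        by (simp add: H_def inner_matrix_mult_right T(1))
      also have "G ** transpose G ** G ** T = G ** (transpose G ** H)"
        by (simp add: H_def matrix_mul_assoc)
      also have "(G ** (transpose G ** H)) \<bullet> H = (transpose G ** H) \<bullet> (transpose G ** H)"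
        by (rule inner_matrix_mult_left)
      finally show ?thesis by (simp add: power2_norm_eq_inner)
    qed
    have "\<mu> * norm G \<le> norm X"
      using norm_rgrad_le[OF X, of A] \<open>norm A > 0\<close> by (simp add: \<mu>_def G_def field_simps)
    then have "(\<mu> * norm G)\<^sup>2 \<le> CARD('p)"
      using \<open>\<mu> > 0\<close> norm_orthonormal_cols[OF X] by (metis power_mono mult_nonneg_nonneg less_imp_le norm_ge_zero)
    \<comment> \<open>The 1 is absorbed using \<open>1 \<le> CARD('p)\<close>.\<close>
    then have "1 + (\<mu> * norm G)\<^sup>2 \<le> 2 * CARD('p)"
      using zero_less_card_finite[where 'a = 'p] by linarith
    then have bound: "(norm H)\<^sup>2 * (1 + (\<mu> * norm G)\<^sup>2) \<le> (norm H)\<^sup>2 * (2 * CARD('p))"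
      by (intro mult_left_mono) auto
    have "norm (transpose G ** H) \<le> norm H * norm G"
      using norm_matrix_matrix_mult_le[of "transpose G" H] by (simp add: norm_transpose mult.commute)
    then have "\<mu>\<^sup>2 * (norm (transpose G ** H))\<^sup>2 \<le> \<mu>\<^sup>2 * (norm H * norm G)\<^sup>2"
      by (intro mult_left_mono power_mono) auto
    then show ?thesis
      using MH bound by (simp add: power_mult_distrib algebra_simps)
  qed
  then have "\<mu> * ((norm G)\<^sup>2 / (2 * CARD('p))) \<le> \<mu> * (norm H)\<^sup>2"
    using \<open>\<mu> > 0\<close> by (intro mult_left_mono) (simp_all add: divide_le_eq mult.commute)
  then have "X \<bullet> (A ** X) + \<mu> * ((norm G)\<^sup>2 / (2 * CARD('p))) \<le> Z \<bullet> (A ** Z)"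
    using dec by linarith
  then show ?thesis
    unfolding \<mu>_def[symmetric] Z_def[symmetric] G_def[symmetric] phi_eq_inner
    by (simp add: \<mu>_def field_simps)
qed

section \<open>Convergence of the gradients along the iterates\<close>

theorem theorem4:
  fixes A :: "real^'n^'n" and X0 :: "real^'p^'n" and X :: "nat \<Rightarrow> real^'p^'n"
  assumes "sym_pos_def A"
    and "1 \<le> CARD('p)" and "CARD('p) \<le> CARD('n)"
    and "orthonormal_cols X0"
    and "X 0 = X0"
    and "\<And>k. rgd_step A (X k) (X (Suc k))"
  shows "(\<lambda>k. rgrad A (X k)) \<longlonglongrightarrow> 0"
proof -
  have orth: "orthonormal_cols (X k)" for k
  proof (induction k)
    case 0
    show ?case by (simp add: assms)
  next
    case (Suc k)
    then show ?case
      using assms(6)[of k] by (auto simp: rgd_step_def orthonormal_cols_search_curve split: if_splits)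
  qed
  define c where "c = 1 / (4 * CARD('p) * norm A)"
  have "A \<noteq> 0"
    using assms(1) by (rule sym_pos_def_nonzero)
  then have "c > 0" by (simp add: c_def)
  have step: "phi A (X (Suc k)) \<le> phi A (X k) - c * (norm (rgrad A (X k)))\<^sup>2" for k
  proof (cases "rgrad A (X k) = 0")
    case True
    then show ?thesis using assms(6)[of k] by (simp add: rgd_step_def)
  next
    case False
    then obtain \<mu> where "is_arg_min (\<lambda>\<nu>. phi A (search_curve A (X k) \<nu>)) (\<lambda>\<nu>. 0 \<le> \<nu>) \<mu>"
      "X (Suc k) = search_curve A (X k) \<mu>"
      using assms(6)[of k] by (auto simp: rgd_step_def)
    \<comment> \<open>The fixed step \<open>1 / norm A\<close> is nonnegative, hence an admissible
      competitor in the line search.\<close>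
    then have "phi A (X (Suc k)) \<le> phi A (search_curve A (X k) (1 / norm A))"
      by (auto simp: is_arg_min_linorder)
    also have "\<dots> \<le> phi A (X k) - c * (norm (rgrad A (X k)))\<^sup>2"
      using phi_search_curve_decrease[OF assms(1) orth] by (simp add: c_def)
    finally show ?thesis .
  qed
  have "decseq (\<lambda>k. phi A (X k))"
  proof (rule decseq_SucI)
    show "phi A (X (Suc k)) \<le> phi A (X k)" for k
      using step[of k] \<open>c > 0\<close> by (smt (verit) mult_nonneg_nonneg zero_le_power2)
  qed
  \<comment> \<open>The bound is uniform in \<open>k\<close> because every iterate has squared
    Frobenius norm \<open>CARD('p)\<close>.\<close>
  moreover have "- (1/2) * (norm A * CARD('p)) \<le> phi A (X k)" for k
    using inner_matrix_mult_self_le[of "X k" A] norm_orthonormal_cols[OF orth[of k]]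
    by (simp add: phi_eq_inner)
  ultimately obtain L where L: "(\<lambda>k. phi A (X k)) \<longlonglongrightarrow> L"
    using decseq_convergent by metis
  \<comment> \<open>The values and their shift share the limit \<open>L\<close>, so the successive
    decreases, which dominate the squared gradient norms after division by \<open>c\<close>, tend to
    zero.\<close>
  have "(\<lambda>k. (phi A (X k) - phi A (X (Suc k))) / c) \<longlonglongrightarrow> (L - L) / c"
    using \<open>c > 0\<close> by (intro tendsto_intros L LIMSEQ_Suc) auto
  then have upper: "(\<lambda>k. (phi A (X k) - phi A (X (Suc k))) / c) \<longlonglongrightarrow> 0"
    by simp
  have "(norm (rgrad A (X k)))\<^sup>2 \<le> (phi A (X k) - phi A (X (Suc k))) / c" for k
    using step[of k] \<open>c > 0\<close> by (simp add: le_divide_eq mult.commute)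
  then have "(\<lambda>k. (norm (rgrad A (X k)))\<^sup>2) \<longlonglongrightarrow> 0"
    by (intro tendsto_sandwich[OF _ _ tendsto_const upper] always_eventually allI) simp_all
  then show ?thesis
    by (simp add: tendsto_norm_zero_iff)
qed

end
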